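(* A domain $\Omega\subseteq\mathbb{R}^N$ is convex if and only if it has a $C^\infty$, strictly convex exhaustion function.
   Context: A domain is a connected open set. $\Omega$ is convex if for all $P,Q\in\Omega$ the closed segment $\{(1-t)P+tQ:0\le t\le 1\}$ lies in $\Omega$. A function $\lambda:\Omega\to\mathbb{R}$ is an exhaustion function if for each $c\in\mathbb{R}$ the set $\{x\in\Omega:\lambda(x)\le c\}$ is a compact subset of $\Omega$. A $C^2$ function on $\Omega$ is strictly convex if its Hessian matrix $\left(\frac{\partial^2\lambda}{\partial x_j\partial x_k}(x)\right)_{j,k}$ is positive definite at each point $x\in\Omega$. *)

theory Defs
  imports "HOL-Analysis.Analysis"
begin

definition partial_deriv :: "'n::finite \<Rightarrow> (real^'n \<Rightarrow> real) \<Rightarrow> real^'n \<Rightarrow> real" where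
  "partial_deriv j f x = deriv (\<lambda>t. f (x + t *\<^sub>R axis j 1)) 0"

(* Intended for open S: the iterated partial derivatives at points of S then depend only on
   the values of f on S.  A function with continuous first partial derivatives is
   differentiable, so asking for (total) differentiability at each stage gives the usual
   "all partial derivatives up to order k exist and are continuous on S". *)
primrec C_k_on :: "nat \<Rightarrow> (real^'n::finite) set \<Rightarrow> (real^'n \<Rightarrow> real) \<Rightarrow> bool" where
  "C_k_on 0 S f \<longleftrightarrow> continuous_on S f"
| "C_k_on (Suc k) S f \<longleftrightarrow>
     (\<forall>x\<in>S. f differentiable (at x)) \<and> (\<forall>j. C_k_on k S (partial_deriv j f))"

definition C_infinity_on :: "(real^'n::finite) set \<Rightarrow> (real^'n \<Rightarrow> real) \<Rightarrow> bool" where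
  "C_infinity_on S f \<longleftrightarrow> (\<forall>k. C_k_on k S f)"

definition hessian :: "(real^'n::finite \<Rightarrow> real) \<Rightarrow> real^'n \<Rightarrow> real^'n^'n" where
  "hessian f x = (\<chi> j k. partial_deriv j (partial_deriv k f) x)"

(* No symmetry clause: this is only applied to Hessians of C^2 functions, which are symmetric. *)
definition positive_definite :: "real^'n^'n::finite \<Rightarrow> bool" where
  "positive_definite A \<longleftrightarrow> (\<forall>v. v \<noteq> 0 \<longrightarrow> v \<bullet> (A *v v) > 0)"

(* Positive definiteness of the Hessian; this is stronger than the strict convexity
   inequality for f along segments (consider x^4 at 0). *)
definition strictly_convex_on :: "(real^'n::finite) set \<Rightarrow> (real^'n \<Rightarrow> real) \<Rightarrow> bool" where
  "strictly_convex_on S f \<longleftrightarrow> C_k_on 2 S f \<and> (\<forall>x\<in>S. positive_definite (hessian f x))"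

definition exhaustion_function :: "(real^'n::finite) set \<Rightarrow> (real^'n \<Rightarrow> real) \<Rightarrow> bool" where
  "exhaustion_function S f \<longleftrightarrow> (\<forall>c. compact {x \<in> S. f x \<le> c})"

end

theory Submission
  imports Defs
begin

text \<open>If \<open>f\<close> is a strictly convex exhaustion function, then the pairs \<open>(P, Q)\<close> whose segment lies in \<open>\<Omega>\<close>
  form a clopen subset of \<open>\<Omega> \<times> \<Omega>\<close>: along such a segment \<open>f\<close> is at most \<open>max (f P) (f Q)\<close>, so a
  convergent sequence of such segments stays in one compact sublevel set.

  Conversely, exhaust a convex \<open>\<Omega>\<close> by compact convex sets \<open>K\<^sub>j\<close>. By separation and compactness there are
  finitely many affine functions that are nonpositive on \<open>K\<^sub>j\<close>, one of which exceeds \<open>j\<close> at each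
  boundary point of norm at most \<open>j\<close>. Composing all of them with a smooth convex function that
  vanishes on the nonpositive reals gives a locally finite sum, smooth and convex, that blows up at
  the boundary; adding \<open>x \<bullet> x\<close> makes it strictly convex and controls infinity.\<close>

section \<open>Partial derivatives\<close>

lemma partial_deriv_has_derivative:
  assumes "(f has_derivative f') (at x)"
  shows "partial_deriv j f x = f' (axis j 1)"
proof -
  interpret f': bounded_linear f'
    using assms by (rule has_derivative_bounded_linear)
  have f: "(f has_derivative f') (at (x + 0 *\<^sub>R axis j 1))"
    using assms by simp
  have "((\<lambda>t. x + t *\<^sub>R axis j 1) has_derivative (\<lambda>t. t *\<^sub>R axis j 1)) (at 0)"
    by (auto intro!: derivative_eq_intros)
  from has_derivative_compose[OF this f]
  have "((\<lambda>t. f (x + t *\<^sub>R axis j 1)) has_derivative (\<lambda>t. f' (t *\<^sub>R axis j 1))) (at 0)" .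
  then have "((\<lambda>t. f (x + t *\<^sub>R axis j 1)) has_real_derivative f' (axis j 1)) (at 0)"
    by (simp add: has_field_derivative_def f'.scaleR mult_commute_abs)
  then show ?thesis
    unfolding partial_deriv_def by (rule DERIV_imp_deriv)
qed

text \<open>A linear map is determined by its values on the axis vectors, so the differentiability
  in \<open>C_k_on\<close> becomes an explicit derivative formula.\<close>

lemma has_derivative_partial_deriv:
  assumes "f differentiable (at x)"
  shows "(f has_derivative (\<lambda>v. \<Sum>j\<in>UNIV. v $ j * partial_deriv j f x)) (at x)"
proof -
  obtain f' where f': "(f has_derivative f') (at x)"
    using assms by (auto simp: differentiable_def)
  interpret f': bounded_linear f'
    using f' by (rule has_derivative_bounded_linear)
  have "f' v = (\<Sum>j\<in>UNIV. v $ j * partial_deriv j f x)" for v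
  proof -
    have "f' v = f' (\<Sum>j\<in>UNIV. v $ j *\<^sub>R axis j 1)"
      by (metis basis_expansion scalar_mult_eq_scaleR)
    also have "\<dots> = (\<Sum>j\<in>UNIV. v $ j * partial_deriv j f x)"
      by (simp add: f'.sum f'.scaleR partial_deriv_has_derivative[OF f'])
    finally show ?thesis .
  qed
  with f' show ?thesis
    by (metis (no_types, lifting) ext)
qed

lemma has_derivative_cong_open:
  assumes "(f has_derivative f') (at x)" "open S" "x \<in> S" "\<And>y. y \<in> S \<Longrightarrow> f y = g y"
  shows "(g has_derivative f') (at x)"
  by (rule has_derivative_transform_within_open[OF assms(1-3)]) (use assms(4) in auto)

lemma differentiable_cong_open:
  assumes "f differentiable (at x)" "open S" "x \<in> S" "\<And>y. y \<in> S \<Longrightarrow> f y = g y"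
  shows "g differentiable (at x)"
  using has_derivative_cong_open[where f = f, OF _ assms(2-4)] assms(1)
  unfolding differentiable_def by metis

text \<open>Only the germ of the function at \<open>x\<close> matters: by openness,
  \<open>x + t *\<^sub>R axis j 1\<close> stays in \<open>S\<close> for small
  \<open>t\<close>.\<close>

lemma partial_deriv_cong_open:
  fixes S :: "(real^'n) set"
  assumes "open S" "x \<in> S" "\<And>y. y \<in> S \<Longrightarrow> f y = g y"
  shows "partial_deriv j f x = partial_deriv j g x"
proof -
  have "((\<lambda>t::real. x + t *\<^sub>R axis j 1) \<longlongrightarrow> x + 0 *\<^sub>R axis j 1) (nhds 0)"
    by (intro tendsto_intros filterlim_ident)
  then have "\<forall>\<^sub>F t in nhds (0::real). x + t *\<^sub>R axis j 1 \<in> S"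
    using assms(1,2) by (auto simp: tendsto_def)
  then have "\<forall>\<^sub>F t in nhds (0::real). f (x + t *\<^sub>R axis j 1) = g (x + t *\<^sub>R axis j 1)"
    by eventually_elim (use assms(3) in auto)
  then show ?thesis
    unfolding partial_deriv_def by (rule deriv_cong_ev) simp
qed

lemma C_k_on_cong:
  assumes "open S" "\<And>y. y \<in> S \<Longrightarrow> f y = g y" "C_k_on k S f"
  shows "C_k_on k S g"
  using assms(2,3)
proof (induction k arbitrary: f g)
  case 0
  then show ?case
    using continuous_on_cong[OF refl, of S f g] by auto
next
  case (Suc k)
  have "g differentiable (at x)" if "x \<in> S" for x
    using Suc.prems(2) that differentiable_cong_open[OF _ assms(1) that Suc.prems(1)] by auto
  moreover have "C_k_on k S (partial_deriv j g)" for j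
    by (rule Suc.IH[of "partial_deriv j f"])
      (use Suc.prems partial_deriv_cong_open[OF assms(1) _ Suc.prems(1)] in auto)
  ultimately show ?case by simp
qed

text \<open>The formula for the derivative is known only on \<open>S\<close>, while
  \<open>partial_deriv j f\<close> is a function on the whole space; \<open>C_k_on_cong\<close>
  bridges the gap.\<close>

lemma C_k_on_SucI:
  assumes "open S" "\<And>x. x \<in> S \<Longrightarrow> (f has_derivative f' x) (at x)"
    and "\<And>j. C_k_on k S (\<lambda>x. f' x (axis j 1))"
  shows "C_k_on (Suc k) S f"
proof -
  have "C_k_on k S (partial_deriv j f)" for j
    by (rule C_k_on_cong[OF assms(1) _ assms(3)[of j]])
      (simp add: partial_deriv_has_derivative[OF assms(2)])
  then show ?thesis
    using assms(2) by (auto simp: differentiable_def)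
qed

lemma C_k_on_add:
  assumes "open S" "C_k_on k S f" "C_k_on k S g"
  shows "C_k_on k S (\<lambda>x. f x + g x)"
  using assms(2,3)
proof (induction k arbitrary: f g)
  case 0
  then show ?case by (auto intro: continuous_on_add)
next
  case (Suc k)
  let ?D = "\<lambda>h x v. \<Sum>j\<in>UNIV. v $ j * partial_deriv j h x"
  have *: "((\<lambda>x. f x + g x) has_derivative (\<lambda>v. ?D f x v + ?D g x v)) (at x)"
    if "x \<in> S" for x
    using Suc.prems that by (intro has_derivative_add has_derivative_partial_deriv) auto
  have "C_k_on k S (\<lambda>x. partial_deriv j f x + partial_deriv j g x)" for j
    using Suc.prems by (intro Suc.IH) auto
  then show ?case
    by (intro C_k_on_SucI[OF assms(1) *])
      (simp_all add: axis_def if_distrib[of "\<lambda>x. x * y" for y] cong: if_cong)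
qed

lemma C_k_on_const:
  fixes S :: "(real^'n) set"
  shows "C_k_on k S (\<lambda>x. c)"
proof (induction k arbitrary: c)
  case (Suc k)
  have "partial_deriv j (\<lambda>x::real^'n. c) = (\<lambda>x. 0)" for j
    by (simp add: partial_deriv_def fun_eq_iff)
  then show ?case
    using Suc[of 0] by simp
qed simp

lemma C_k_on_inner_self:
  fixes S :: "(real^'n) set"
  assumes "open S"
  shows "C_k_on k S (\<lambda>x. x \<bullet> x)"
proof (cases k)
  case 0
  then show ?thesis by (auto intro: continuous_intros)
next
  case (Suc m)
  have "C_k_on m S (\<lambda>x. 2 * (x \<bullet> axis j 1))" for j
  proof (cases m)
    case 0
    then show ?thesis by (auto intro!: continuous_intros)
  next
    case (Suc l)
    show ?thesis
      unfolding Suc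
      by (rule C_k_on_SucI[OF assms, where f' = "\<lambda>x v. 2 * (v \<bullet> axis j 1)"])
        (auto intro!: derivative_eq_intros C_k_on_const)
  qed
  then show ?thesis
    unfolding Suc
    by (intro C_k_on_SucI[OF assms, where f' = "\<lambda>x v. 2 * (x \<bullet> v)"])
      (auto intro!: derivative_eq_intros simp: inner_commute)
qed

section \<open>Convexity along segments\<close>

text \<open>The inner sum is the derivative of \<open>partial_deriv k f\<close> in direction
  \<open>v\<close>, which is the shape that differentiating twice along a line produces.\<close>

lemma inner_hessian:
  "v \<bullet> (hessian f x *v v) =
    (\<Sum>k\<in>UNIV. v $ k * (\<Sum>j\<in>UNIV. v $ j * partial_deriv j (partial_deriv k f) x))"
proof -
  have "v \<bullet> (hessian f x *v v) =
      (\<Sum>j\<in>UNIV. \<Sum>k\<in>UNIV. v $ k * (v $ j * partial_deriv j (partial_deriv k f) x))"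
    by (simp add: inner_vec_def matrix_vector_mult_def hessian_def sum_distrib_left mult_ac)
  also have "\<dots> = (\<Sum>k\<in>UNIV. \<Sum>j\<in>UNIV. v $ k * (v $ j * partial_deriv j (partial_deriv k f) x))"
    by (rule sum.swap)
  finally show ?thesis by (simp add: sum_distrib_left)
qed

text \<open>Along the segment, the second derivative is the Hessian form in direction
  \<open>Q - P\<close>, so the restriction is convex on the unit interval. Only the segment is
  assumed to lie in \<open>S\<close>, since convexity of \<open>S\<close> is what this lemma serves
  to prove.\<close>

lemma strictly_convex_on_segment_le_max:
  fixes S :: "(real^'n) set"
  assumes f: "strictly_convex_on S f" and PQ: "closed_segment P Q \<subseteq> S" and x: "x \<in> closed_segment P Q"
  shows "f x \<le> max (f P) (f Q)"
proof -
  define v where "v = Q - P"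
  define l where "l t = P + t *\<^sub>R v" for t
  have l: "l t \<in> S" if "t \<in> {0..1}" for t
  proof -
    have "l t = (1 - t) *\<^sub>R P + t *\<^sub>R Q"
      by (simp add: l_def v_def algebra_simps)
    then show ?thesis
      using PQ that by (auto simp: closed_segment_def)
  qed
  have C2: "f differentiable (at y)" "partial_deriv k f differentiable (at y)" if "y \<in> S" for y k
    using f that by (auto simp: strictly_convex_on_def numeral_2_eq_2)
  have chain: "((\<lambda>t. g (l t)) has_real_derivative (\<Sum>j\<in>UNIV. v $ j * partial_deriv j g (l t))) (at t)"
    if "g differentiable (at (l t))" for g t
  proof -
    have "(l has_derivative (\<lambda>s. s *\<^sub>R v)) (at t)"
      unfolding l_def by (auto intro!: derivative_eq_intros)
    from has_derivative_compose[OF this has_derivative_partial_deriv[OF that]]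
    show ?thesis
      by (simp add: has_field_derivative_def mult.assoc mult_commute_abs flip: sum_distrib_left)
  qed
  have d2: "((\<lambda>t. \<Sum>k\<in>UNIV. v $ k * partial_deriv k f (l t)) has_real_derivative
      v \<bullet> (hessian f (l t) *v v)) (at t)" if "t \<in> {0..1}" for t
    unfolding inner_hessian
    by (intro DERIV_sum DERIV_cmult chain C2 l that)
  \<comment> \<open>Positive definiteness says nothing about \<open>v = 0\<close>, which occurs when
    \<open>P = Q\<close>.\<close>
  have "v \<bullet> (hessian f (l t) *v v) \<ge> 0" if "t \<in> {0..1}" for t
    using f l[OF that] by (cases "v = 0")
      (auto simp: strictly_convex_on_def positive_definite_def intro: less_imp_le)
  then have "convex_on {0..1} (\<lambda>t. f (l t))"
    using d2 chain C2(1) l by (intro f''_ge0_imp_convex) auto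
  moreover obtain t where t: "t \<in> {0..1}" "x = l t"
    using x by (auto simp: l_def v_def closed_segment_def algebra_simps)
  ultimately have "f (l ((1 - t) *\<^sub>R 0 + t *\<^sub>R 1)) \<le> (1 - t) * f (l 0) + t * f (l 1)"
    by (intro convex_onD) auto
  also have "\<dots> \<le> (1 - t) * max (f P) (f Q) + t * max (f P) (f Q)"
    using t by (intro add_mono mult_left_mono) (auto simp: l_def v_def)
  finally show ?thesis
    using t by (simp add: algebra_simps)
qed

section \<open>Convexity as a clopen condition on pairs of points\<close>

lemma compact_segment_neighbourhood:
  fixes P Q :: "'a::real_normed_vector"
  assumes "open S" "closed_segment P Q \<subseteq> S"
  obtains e where "e > 0" "\<And>P' Q'. dist P' P < e \<Longrightarrow> dist Q' Q < e \<Longrightarrow> closed_segment P' Q' \<subseteq> S"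
proof -
  obtain e where e: "e > 0" "(\<Union>x\<in>closed_segment P Q. ball x e) \<subseteq> S"
    using compact_subset_open_imp_ball_epsilon_subset[OF compact_segment assms] .
  have "closed_segment P' Q' \<subseteq> S" if d: "dist P' P < e" "dist Q' Q < e" for P' Q'
  proof
    fix y assume "y \<in> closed_segment P' Q'"
    then obtain t where t: "0 \<le> t" "t \<le> 1" "y = (1 - t) *\<^sub>R P' + t *\<^sub>R Q'"
      by (auto simp: closed_segment_def)
    \<comment> \<open>Compare \<open>y\<close> with the point of the original segment that has the
      same parameter: their difference is a convex combination of the endpoint
      displacements.\<close>
    define x where "x = (1 - t) *\<^sub>R P + t *\<^sub>R Q"
    have "x - y = (1 - t) *\<^sub>R (P - P') + t *\<^sub>R (Q - Q')"
      by (simp add: x_def t algebra_simps)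
    moreover have "(1 - t) *\<^sub>R (P - P') + t *\<^sub>R (Q - Q') \<in> ball 0 e"
      using convex_ball[of 0 e] t d
      by (intro convexD) (simp_all add: dist_norm norm_minus_commute)
    ultimately have "y \<in> ball x e"
      by (simp add: dist_norm[of x y])
    moreover have "x \<in> closed_segment P Q"
      using t by (auto simp: x_def closed_segment_def)
    ultimately show "y \<in> S" using e(2) by blast
  qed
  with that e(1) show thesis by blast
qed

lemma convex_of_strictly_convex_exhaustion:
  fixes S :: "(real^'n) set"
  assumes S: "open S" "connected S" and f: "strictly_convex_on S f" "exhaustion_function S f"
  shows "convex S"
proof -
  define T where "T = {z \<in> S \<times> S. closed_segment (fst z) (snd z) \<subseteq> S}"
  have cont: "continuous_on S f"
    using f(1) by (auto simp: strictly_convex_on_def numeral_2_eq_2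
        intro!: differentiable_imp_continuous_on differentiable_at_imp_differentiable_on)
  have "open T"
  proof (subst open_subopen, intro ballI)
    fix z assume z: "z \<in> T"
    obtain P Q where PQ: "z = (P, Q)" by force
    obtain e where e: "e > 0"
      "\<And>P' Q'. dist P' P < e \<Longrightarrow> dist Q' Q < e \<Longrightarrow> closed_segment P' Q' \<subseteq> S"
      using compact_segment_neighbourhood[OF S(1), of P Q] z PQ by (auto simp: T_def)
    have "ball P e \<times> ball Q e \<subseteq> T"
    proof
      fix w assume w: "w \<in> ball P e \<times> ball Q e"
      then have "closed_segment (fst w) (snd w) \<subseteq> S"
        by (intro e(2)) (auto simp: dist_commute)
      then show "w \<in> T"
        by (auto simp: T_def subset_eq mem_Times_iff)
    qed
    then show "\<exists>U. open U \<and> z \<in> U \<and> U \<subseteq> T"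
      using e(1) PQ by (intro exI[of _ "ball P e \<times> ball Q e"]) (auto intro: open_Times)
  qed
  have T_sub: "T \<subseteq> S \<times> S"
    by (auto simp: T_def)
  have "z \<in> T" if lim: "s \<longlonglongrightarrow> z" and s: "\<And>n. s n \<in> T" and z: "z \<in> S \<times> S" for s z
  proof -
    obtain P Q where PQ: "z = (P, Q)" by force
    define p q where "p n = fst (s n)" and "q n = snd (s n)" for n
    have pq: "p \<longlonglongrightarrow> P" "q \<longlonglongrightarrow> Q"
      using tendsto_fst[OF lim] tendsto_snd[OF lim] by (auto simp: p_def[abs_def] q_def[abs_def] PQ)
    have seg: "closed_segment (p n) (q n) \<subseteq> S" for n
      using s[of n] by (auto simp: T_def p_def q_def)
    have "isCont f P" "isCont f Q"
      using cont S(1) z PQ by (auto simp: continuous_on_eq_continuous_at)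
    then have "(\<lambda>n. f (p n)) \<longlonglongrightarrow> f P" "(\<lambda>n. f (q n)) \<longlonglongrightarrow> f Q"
      using pq by (auto intro: isCont_tendsto_compose)
    then have "Bseq (\<lambda>n. f (p n))" "Bseq (\<lambda>n. f (q n))"
      by (auto intro!: convergent_imp_Bseq simp: convergent_def)
    then obtain M1 M2 where M: "\<And>n. \<bar>f (p n)\<bar> \<le> M1" "\<And>n. \<bar>f (q n)\<bar> \<le> M2"
      by (metis BseqE real_norm_def)
    \<comment> \<open>One sublevel set contains all the approximating segments, because
      \<open>f\<close> is bounded along both endpoint sequences.\<close>
    define K where "K = {x \<in> S. f x \<le> max M1 M2}"
    have K: "compact K" using f(2) by (simp add: K_def exhaustion_function_def)
    have inK: "x \<in> K" if "x \<in> closed_segment (p n) (q n)" for x n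
    proof -
      have "f (p n) \<le> M1" "f (q n) \<le> M2"
        using M[of n] by linarith+
      then show ?thesis
        using strictly_convex_on_segment_le_max[OF f(1) seg that] seg that by (force simp: K_def)
    qed
    have "x \<in> K" if x: "x \<in> closed_segment P Q" for x
    proof -
      obtain t where t: "0 \<le> t" "t \<le> 1" "x = (1 - t) *\<^sub>R P + t *\<^sub>R Q"
        using x by (auto simp: closed_segment_def)
      \<comment> \<open>For fixed \<open>t\<close>, the corresponding points of the approximating
        segments converge to \<open>x\<close>, and \<open>K\<close> is closed.\<close>
      have lim: "(\<lambda>n. (1 - t) *\<^sub>R p n + t *\<^sub>R q n) \<longlonglongrightarrow> x"
        unfolding t by (intro tendsto_intros pq)
      have "(1 - t) *\<^sub>R p n + t *\<^sub>R q n \<in> K" for n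
        using t by (intro inK[of _ n]) (auto simp: closed_segment_def)
      then show ?thesis
        by (rule closed_sequentially[OF compact_imp_closed[OF K] _ lim])
    qed
    then show ?thesis
      using z PQ by (auto simp: T_def K_def)
  qed
  then have "closedin (top_of_set (S \<times> S)) T"
    unfolding closedin_limpt islimpt_sequential by (metis (no_types, lifting) DiffD1 T_sub)
  moreover have "openin (top_of_set (S \<times> S)) T"
    using \<open>open T\<close> T_sub by (intro open_subset)
  moreover have "connected (S \<times> S)"
    using S(2) by (intro connected_Times)
  ultimately have "T = {} \<or> T = S \<times> S"
    unfolding connected_clopen by blast
  \<comment> \<open>The diagonal excludes \<open>T = {}\<close> unless \<open>S\<close> itself is
    empty.\<close>
  moreover have "(P, P) \<in> T" if "P \<in> S" for P
    using that by (auto simp: T_def)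
  ultimately have "S \<times> S \<subseteq> T" by auto
  have "closed_segment P Q \<subseteq> S" if "P \<in> S" "Q \<in> S" for P Q
  proof -
    have "(P, Q) \<in> T"
      using that \<open>S \<times> S \<subseteq> T\<close> by blast
    then show ?thesis
      by (simp add: T_def)
  qed
  then show ?thesis
    by (simp add: convex_contains_segment)
qed

section \<open>A flat convex function\<close>

text \<open>\<open>flat i\<close> is the \<open>i\<close>-th derivative of \<open>t exp (-1/t)\<close>, extended by \<open>0\<close> to \<open>t \<le> 0\<close>.
  Its second derivative is \<open>t\<^sup>-\<^sup>3 exp (-1/t)\<close>, so it is convex on the whole line, which
  \<open>exp (-1/t)\<close> itself is not.\<close>

primrec flat_poly :: "nat \<Rightarrow> real poly" where
  "flat_poly 0 = [:1, 1:]"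
| "flat_poly (Suc i) = [:0, 0, 1:] * (flat_poly i - pderiv (flat_poly i))"

definition flat :: "nat \<Rightarrow> real \<Rightarrow> real" where
  "flat i t = (if t \<le> 0 then 0
     else (case i of 0 \<Rightarrow> t | Suc k \<Rightarrow> poly (flat_poly k) (1 / t)) * exp (- 1 / t))"

lemma flat_nonpos [simp]: "t \<le> 0 \<Longrightarrow> flat i t = 0"
  by (simp add: flat_def)

lemma poly_mult_exp_minus_tendsto_0:
  fixes p :: "real poly"
  shows "((\<lambda>s. poly p s * exp (- s)) \<longlongrightarrow> 0) at_top"
proof -
  have "((\<lambda>s. \<Sum>i\<le>degree p. coeff p i * (s ^ i / exp s)) \<longlongrightarrow> 0) at_top"
    by (intro tendsto_null_sum tendsto_mult_right_zero tendsto_power_div_exp_0)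
  then show ?thesis
    by (simp add: poly_altdef sum_distrib_right exp_minus divide_inverse mult.assoc)
qed

lemma flat_quotient_tendsto_0:
  fixes p :: "real poly"
  shows "((\<lambda>t. poly p (1 / t) * exp (- 1 / t)) \<longlongrightarrow> 0) (at_right 0)"
  using filterlim_compose[OF poly_mult_exp_minus_tendsto_0 filterlim_inverse_at_top_right]
  by (simp add: inverse_eq_divide)

text \<open>The explicit factor \<open>t\<close> cancels in the difference quotient at the origin,
  leaving a polynomial in \<open>1 / t\<close> times a decaying exponential.\<close>

lemma has_derivative_flat_at_0:
  fixes h :: "real \<Rightarrow> real"
  assumes "\<And>t. t \<le> 0 \<Longrightarrow> h t = 0"
    and "\<And>t. t > 0 \<Longrightarrow> h t = t * (poly p (1 / t) * exp (- 1 / t))"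
  shows "(h has_real_derivative 0) (at 0)"
proof -
  have "((\<lambda>t. h t / t) \<longlongrightarrow> 0) (at_left 0)"
  proof (rule Lim_transform_eventually[OF tendsto_const])
    show "\<forall>\<^sub>F t in at_left 0. 0 = h t / t"
      by (auto simp: eventually_at_filter assms(1))
  qed
  moreover have "((\<lambda>t. h t / t) \<longlongrightarrow> 0) (at_right 0)"
  proof (rule Lim_transform_eventually[OF flat_quotient_tendsto_0[of p]])
    show "\<forall>\<^sub>F t in at_right 0. poly p (1 / t) * exp (- 1 / t) = h t / t"
      by (auto simp: eventually_at_filter assms(2))
  qed
  ultimately show ?thesis
    by (simp add: has_field_derivative_iff assms(1) filterlim_split_at)
qed

text \<open>With \<open>s = 1 / t\<close>, the derivative in \<open>t\<close> of
  \<open>p(s) exp(-s)\<close> is \<open>s^2 (p(s) - p'(s)) exp(-s)\<close>, which is the recursion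
  of \<open>flat_poly\<close>. The index is shifted by one because \<open>flat 0\<close> has the
  factor \<open>t\<close>, which is not a polynomial in \<open>1 / t\<close>.\<close>

lemma flat_has_derivative: "(flat i has_real_derivative flat (Suc i) t) (at t)"
proof -
  consider "t < 0" | "t = 0" | "t > 0" by linarith
  then show ?thesis
  proof cases
    case 1
    then have "(flat i has_real_derivative 0) (at t)"
      by (rule_tac has_field_derivative_transform_within_open[of "\<lambda>_. 0" 0 t "{..<0}"]) auto
    with 1 show ?thesis by simp
  next
    case 2
    have "\<exists>p. \<forall>t>0. flat i t = t * (poly p (1 / t) * exp (- 1 / t))"
    proof (cases i)
      case 0
      then show ?thesis by (intro exI[of _ 1]) (simp add: flat_def)
    next
      case (Suc k)
      \<comment> \<open>Prepending \<open>0\<close> multiplies the polynomial by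
        \<open>1 / t\<close>, compensating the factor \<open>t\<close>.\<close>
      then show ?thesis by (intro exI[of _ "pCons 0 (flat_poly k)"]) (simp add: flat_def)
    qed
    then show ?thesis
      using has_derivative_flat_at_0[of "flat i"] 2 by auto
  next
    case 3
    define h where "h = (\<lambda>t. (case i of 0 \<Rightarrow> t | Suc k \<Rightarrow> poly (flat_poly k) (1 / t)) * exp (- 1 / t))"
    have "(h has_real_derivative flat (Suc i) t) (at t)"
    proof (cases i)
      case 0
      show ?thesis
        unfolding h_def 0 flat_def using 3
        by (auto intro!: derivative_eq_intros simp: field_simps power2_eq_square)
    next
      case (Suc k)
      have "((\<lambda>t. poly (flat_poly k) (1 / t)) has_real_derivative
          poly (pderiv (flat_poly k)) (1 / t) * (- 1 / t ^ 2)) (at t)"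
        using 3 by (intro DERIV_chain2[OF poly_DERIV])
          (auto intro!: derivative_eq_intros simp: power2_eq_square)
      moreover have "((\<lambda>t. exp (- 1 / t)) has_real_derivative exp (- 1 / t) * (1 / t ^ 2)) (at t)"
        using 3 by (auto intro!: derivative_eq_intros simp: power2_eq_square)
      ultimately show ?thesis
        unfolding h_def Suc nat.case
        by (rule DERIV_cong[OF DERIV_mult])
          (use 3 in \<open>simp add: flat_def algebra_simps power2_eq_square\<close>)
    qed
    moreover have "h s = flat i s" if "s \<in> {0<..}" for s
      using that by (simp add: h_def flat_def)
    ultimately show ?thesis
      using 3 by (rule_tac has_field_derivative_transform_within_open[of h _ t "{0<..}"]) auto
  qed
qed

lemma flat_0_nonneg: "0 \<le> flat 0 t"
  by (simp add: flat_def)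

lemma flat_2_nonneg: "0 \<le> flat 2 t"
  by (simp add: flat_def numeral_2_eq_2 pderiv_pCons)

text \<open>Since \<open>exp (- 1 / t)\<close> increases for positive \<open>t\<close>, it is at
  least \<open>exp (- 1)\<close> here. This linear growth drives the blow-up at the
  boundary.\<close>

lemma flat_0_ge: "t * exp (- 1) \<le> flat 0 t" if "t \<ge> 1"
  using that by (simp add: flat_def field_simps)

section \<open>Locally finite sums of ridge functions\<close>

text \<open>A pair \<open>a\<close> encodes the affine function \<open>x \<mapsto> fst a \<bullet> x + snd a\<close>. Restricting the sum to
  the finitely many positive ones avoids the value \<open>0\<close> of a sum over an infinite index set.\<close>

definition ridge_sum ::
  "('a::real_inner \<times> real) set \<Rightarrow> ('a \<times> real \<Rightarrow> real) \<Rightarrow> (real \<Rightarrow> real) \<Rightarrow> 'a \<Rightarrow> real" where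
  "ridge_sum A w \<phi> x =
     (\<Sum>a | a \<in> A \<and> 0 < fst a \<bullet> x + snd a. w a * \<phi> (fst a \<bullet> x + snd a))"

text \<open>Finiteness is asked of the open half-spaces where the affine functions are positive:
  elsewhere a profile vanishing on the nonpositive reals contributes nothing.\<close>

definition locally_finite_halfspaces :: "'a::real_inner set \<Rightarrow> ('a \<times> real) set \<Rightarrow> bool" where
  "locally_finite_halfspaces S A \<longleftrightarrow>
     (\<forall>x\<in>S. \<exists>U. open U \<and> x \<in> U \<and> finite {a \<in> A. \<exists>y\<in>U. 0 < fst a \<bullet> y + snd a})"

text \<open>\<open>U\<close> and \<open>B\<close> are chosen before \<open>w\<close> and
  \<open>\<phi>\<close>, so the same finite index set serves a ridge sum and its derivative.\<close>

lemma ridge_sum_locally: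
  assumes "locally_finite_halfspaces S A" "x \<in> S"
  obtains U B where "open U" "x \<in> U" "finite B"
    "\<And>w \<phi> y. (\<And>t. t \<le> 0 \<Longrightarrow> \<phi> t = 0) \<Longrightarrow> y \<in> U \<Longrightarrow>
       ridge_sum A w \<phi> y = (\<Sum>a\<in>B. w a * \<phi> (fst a \<bullet> y + snd a))"
proof -
  obtain U where U: "open U" "x \<in> U" "finite {a \<in> A. \<exists>y\<in>U. 0 < fst a \<bullet> y + snd a}" (is "finite ?B")
    using assms by (auto simp: locally_finite_halfspaces_def)
  have "ridge_sum A w \<phi> y = (\<Sum>a\<in>?B. w a * \<phi> (fst a \<bullet> y + snd a))"
    if "\<And>t. t \<le> 0 \<Longrightarrow> \<phi> t = 0" "y \<in> U" for w \<phi> y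
    unfolding ridge_sum_def
  proof (intro sum.mono_neutral_left U ballI)
    fix a assume "a \<in> ?B - {a. a \<in> A \<and> 0 < fst a \<bullet> y + snd a}"
    then have "fst a \<bullet> y + snd a \<le> 0" by auto
    then show "w a * \<phi> (fst a \<bullet> y + snd a) = 0" by (simp add: that(1))
  qed (use that(2) in auto)
  then show thesis by (rule that[OF U])
qed

text \<open>Near \<open>x\<close> the sum is finite and can be differentiated term by term; the
  result is again a ridge sum, with the inner derivative absorbed into the weights.\<close>

lemma ridge_sum_has_derivative:
  assumes A: "locally_finite_halfspaces S A" "x \<in> S"
    and \<phi>: "\<And>t. t \<le> 0 \<Longrightarrow> \<phi> t = 0" "\<And>t. t \<le> 0 \<Longrightarrow> \<phi>' t = 0"
      "\<And>t. (\<phi> has_real_derivative \<phi>' t) (at t)"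
  shows "(ridge_sum A w \<phi> has_derivative (\<lambda>v. ridge_sum A (\<lambda>a. w a * (fst a \<bullet> v)) \<phi>' x)) (at x)"
proof -
  obtain U B where U: "open U" "x \<in> U" "finite B"
    and eq: "\<And>w \<phi> y. (\<And>t. t \<le> 0 \<Longrightarrow> \<phi> t = 0) \<Longrightarrow> y \<in> U \<Longrightarrow>
       ridge_sum A w \<phi> y = (\<Sum>a\<in>B. w a * \<phi> (fst a \<bullet> y + snd a))"
    using ridge_sum_locally[OF A] by blast
  have "((\<lambda>y. \<phi> (fst a \<bullet> y + snd a)) has_derivative (\<lambda>v. \<phi>' (fst a \<bullet> x + snd a) * (fst a \<bullet> v))) (at x)"
    for a
  proof -
    have "((\<lambda>y. fst a \<bullet> y + snd a) has_derivative (\<lambda>v. fst a \<bullet> v)) (at x)"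
      by (auto intro!: derivative_eq_intros)
    from has_derivative_compose[OF this \<phi>(3)[THEN has_field_derivative_imp_has_derivative]]
    show ?thesis .
  qed
  then have "((\<lambda>y. \<Sum>a\<in>B. w a * \<phi> (fst a \<bullet> y + snd a)) has_derivative
      (\<lambda>v. \<Sum>a\<in>B. w a * (\<phi>' (fst a \<bullet> x + snd a) * (fst a \<bullet> v)))) (at x)"
    by (intro has_derivative_sum has_derivative_mult_right)
  also have "(\<lambda>v. \<Sum>a\<in>B. w a * (\<phi>' (fst a \<bullet> x + snd a) * (fst a \<bullet> v))) =
      (\<lambda>v. ridge_sum A (\<lambda>a. w a * (fst a \<bullet> v)) \<phi>' x)"
    using eq[of \<phi>' x, OF \<phi>(2) U(2)] by (simp add: mult_ac)
  finally show ?thesis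
    by (rule has_derivative_transform_within_open[OF _ U(1,2)]) (use eq[of \<phi>, OF \<phi>(1)] in auto)
qed

lemma ridge_sum_flat_has_derivative:
  assumes "locally_finite_halfspaces S A" "x \<in> S"
  shows "(ridge_sum A w (flat i) has_derivative
    (\<lambda>v. ridge_sum A (\<lambda>a. w a * (fst a \<bullet> v)) (flat (Suc i)) x)) (at x)"
  by (rule ridge_sum_has_derivative[OF assms]) (auto intro: flat_has_derivative)

text \<open>Each differentiation replaces \<open>flat i\<close> by \<open>flat (Suc i)\<close> and
  changes the weights, so the induction must generalise over both.\<close>

lemma C_k_on_ridge_sum:
  fixes S :: "(real^'n) set"
  assumes "open S" "locally_finite_halfspaces S A"
  shows "C_k_on k S (ridge_sum A w (flat i))"
proof (induction k arbitrary: w i)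
  case 0
  show ?case
    using ridge_sum_flat_has_derivative[OF assms(2), THEN has_derivative_continuous]
    by (auto intro!: continuous_at_imp_continuous_on)
next
  case (Suc k)
  show ?case
    by (rule C_k_on_SucI[OF assms(1) ridge_sum_flat_has_derivative[OF assms(2)] Suc])
qed

lemma ridge_sum_nonneg:
  assumes "\<And>a. 0 \<le> w a" "\<And>t. 0 \<le> \<phi> t"
  shows "0 \<le> ridge_sum A w \<phi> x"
  unfolding ridge_sum_def using assms by (intro sum_nonneg) auto

text \<open>Local finiteness makes the index set at \<open>x\<close> finite; over an infinite one
  the sum would default to \<open>0\<close>.\<close>

lemma ridge_sum_ge_summand:
  assumes A: "locally_finite_halfspaces S A" "x \<in> S" "a \<in> A"
    and "0 < fst a \<bullet> x + snd a" "\<And>a. 0 \<le> w a" "\<And>t. 0 \<le> \<phi> t"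
  shows "w a * \<phi> (fst a \<bullet> x + snd a) \<le> ridge_sum A w \<phi> x"
proof -
  obtain U where U: "x \<in> U" "finite {a \<in> A. \<exists>y\<in>U. 0 < fst a \<bullet> y + snd a}"
    using A by (auto simp: locally_finite_halfspaces_def)
  have "finite {a \<in> A. 0 < fst a \<bullet> x + snd a}"
    by (rule finite_subset[OF _ U(2)]) (use U(1) in auto)
  then show ?thesis
    unfolding ridge_sum_def
    using assms by (intro member_le_sum[where f = "\<lambda>a. w a * \<phi> (fst a \<bullet> x + snd a)"]) auto
qed

section \<open>Hessian of the candidate exhaustion function\<close>

lemma sum_mult_ridge_sum:
  "(\<Sum>k\<in>I. c k * ridge_sum A (w k) \<phi> x) = ridge_sum A (\<lambda>a. \<Sum>k\<in>I. c k * w k a) \<phi> x"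
proof -
  have "(\<Sum>k\<in>I. c k * ridge_sum A (w k) \<phi> x) =
      (\<Sum>k\<in>I. \<Sum>a | a \<in> A \<and> 0 < fst a \<bullet> x + snd a. c k * w k a * \<phi> (fst a \<bullet> x + snd a))"
    by (simp add: ridge_sum_def sum_distrib_left mult_ac)
  also have "\<dots> = ridge_sum A (\<lambda>a. \<Sum>k\<in>I. c k * w k a) \<phi> x"
    unfolding ridge_sum_def sum_distrib_right by (rule sum.swap)
  finally show ?thesis .
qed

text \<open>The Hessian form at \<open>v\<close> is \<open>2 * (v \<bullet> v)\<close> plus a ridge
  sum with weights \<open>(fst a \<bullet> v)\<^sup>2\<close> and profile \<open>flat 2\<close>,
  which is nonnegative.\<close>

lemma strictly_convex_on_inner_self_plus_ridge_sum:
  fixes S :: "(real^'n) set"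
  assumes S: "open S" and A: "locally_finite_halfspaces S A"
  defines "f \<equiv> \<lambda>x. x \<bullet> x + ridge_sum A (\<lambda>_. 1) (flat 0) x"
  shows "C_infinity_on S f" "strictly_convex_on S f"
proof -
  have C: "C_k_on k S f" for k
    unfolding f_def by (intro C_k_on_add C_k_on_inner_self C_k_on_ridge_sum S A)
  then show "C_infinity_on S f" by (simp add: C_infinity_on_def)
  have D1: "(f has_derivative (\<lambda>v. 2 * (x \<bullet> v) + ridge_sum A (\<lambda>a. 1 * (fst a \<bullet> v)) (flat (Suc 0)) x)) (at x)"
    if "x \<in> S" for x
    unfolding f_def
    by (intro has_derivative_add ridge_sum_flat_has_derivative[OF A that])
      (auto intro!: derivative_eq_intros simp: inner_commute)
  have D2: "(partial_deriv k f has_derivative (\<lambda>v. 2 * (v $ k) +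
      ridge_sum A (\<lambda>a. 1 * (fst a \<bullet> axis k 1) * (fst a \<bullet> v)) (flat (Suc (Suc 0))) x)) (at x)"
    (is "(_ has_derivative ?D) _") if "x \<in> S" for x k
  proof -
    have "((\<lambda>x. 2 * (x \<bullet> axis k 1)) has_derivative (\<lambda>v. 2 * (v $ k))) (at x)"
      by (auto intro!: derivative_eq_intros simp: cart_eq_inner_axis)
    from has_derivative_add[OF this ridge_sum_flat_has_derivative[OF A that]]
    have "((\<lambda>x. 2 * (x \<bullet> axis k 1) +
        ridge_sum A (\<lambda>a. 1 * (fst a \<bullet> axis k 1)) (flat (Suc 0)) x) has_derivative ?D) (at x)" .
    then show ?thesis
      by (rule has_derivative_cong_open[OF _ S that])
        (simp add: partial_deriv_has_derivative[OF D1])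
  qed
  have "v \<bullet> (hessian f x *v v) > 0" if x: "x \<in> S" and v: "v \<noteq> 0" for x v
  proof -
    have "(\<Sum>j\<in>UNIV. v $ j * partial_deriv j (partial_deriv k f) x) = 2 * (v $ k) +
      ridge_sum A (\<lambda>a. (fst a $ k) * (fst a \<bullet> v)) (flat 2) x" for k
    proof -
      have "partial_deriv k f differentiable (at x)"
        using D2[OF x] by (auto simp: differentiable_def)
      \<comment> \<open>\<open>partial_deriv k f\<close> has two formulas for its derivative, the
        generic one and \<open>D2\<close>; uniqueness equates them at \<open>v\<close>.\<close>
      from fun_cong[OF has_derivative_unique[OF has_derivative_partial_deriv[OF this] D2[OF x]], of v]
      show ?thesis
        by (simp add: inner_axis numeral_2_eq_2)
    qed
    then have "v \<bullet> (hessian f x *v v) = (\<Sum>k\<in>UNIV. 2 * (v $ k * v $ k)) +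
        (\<Sum>k\<in>UNIV. v $ k * ridge_sum A (\<lambda>a. (fst a $ k) * (fst a \<bullet> v)) (flat 2) x)"
      by (simp add: inner_hessian ring_distribs sum.distrib mult_ac)
    also have "\<dots> = 2 * (v \<bullet> v) + ridge_sum A (\<lambda>a. (fst a \<bullet> v)\<^sup>2) (flat 2) x"
      by (simp add: sum_mult_ridge_sum inner_vec_def sum_distrib_left power2_eq_square
          sum_distrib_right mult_ac)
    also have "\<dots> > 0"
      using v by (intro add_pos_nonneg ridge_sum_nonneg flat_2_nonneg) auto
    finally show ?thesis .
  qed
  then show "strictly_convex_on S f"
    using C by (auto simp: strictly_convex_on_def positive_definite_def)
qed

section \<open>Half-spaces exhausting a convex set\<close>

lemma separating_affine_function:
  fixes K :: "'a::euclidean_space set"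
  assumes "convex K" "compact K" "p \<notin> K"
  obtains b c where "\<And>x. x \<in> K \<Longrightarrow> b \<bullet> x + c \<le> 0" "b \<bullet> p + c > T"
proof -
  obtain a d where a: "a \<bullet> p < d" "\<And>x. x \<in> K \<Longrightarrow> d < a \<bullet> x"
    using separating_hyperplane_closed_point[OF assms(1) compact_imp_closed[OF assms(2)] assms(3)]
    by auto
  \<comment> \<open>Scaling \<open>d - a \<bullet> x\<close> by this \<open>s\<close> gives the
    value \<open>\<bar>T\<bar> + 1\<close> at \<open>p\<close> and keeps the sign on
    \<open>K\<close>.\<close>
  define s where "s = (\<bar>T\<bar> + 1) / (d - a \<bullet> p)"
  have s: "s > 0" using a(1) by (simp add: s_def)
  have "(- s *\<^sub>R a) \<bullet> x + s * d = s * (d - a \<bullet> x)" for x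
    by (simp add: algebra_simps)
  moreover have "s * (d - a \<bullet> p) = \<bar>T\<bar> + 1"
    using a(1) by (simp add: s_def)
  moreover have "s * (d - a \<bullet> x) \<le> 0" if "x \<in> K" for x
    using s a(2)[OF that] by (simp add: mult_le_0_iff)
  ultimately show thesis
    by (intro that[of "- s *\<^sub>R a" "s * d"]) auto
qed

text \<open>The open half-spaces where the separating functions exceed \<open>T\<close> cover
  \<open>C\<close>; a finite subcover gives \<open>A\<close>.\<close>

lemma separating_affine_functions:
  fixes K C :: "'a::euclidean_space set"
  assumes K: "convex K" "compact K" and C: "compact C" "C \<inter> K = {}"
  obtains A where "finite A" "\<And>a x. a \<in> A \<Longrightarrow> x \<in> K \<Longrightarrow> fst a \<bullet> x + snd a \<le> 0"
    "\<And>p. p \<in> C \<Longrightarrow> \<exists>a\<in>A. T < fst a \<bullet> p + snd a"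
proof -
  have "\<exists>a. (\<forall>x\<in>K. fst a \<bullet> x + snd a \<le> 0) \<and> T < fst a \<bullet> p + snd a" if "p \<in> C" for p
    using separating_affine_function[OF K, of p T] that C(2)
    by (metis IntI empty_iff fst_conv snd_conv)
  then obtain g where g: "\<And>p x. p \<in> C \<Longrightarrow> x \<in> K \<Longrightarrow> fst (g p) \<bullet> x + snd (g p) \<le> 0"
      "\<And>p. p \<in> C \<Longrightarrow> T < fst (g p) \<bullet> p + snd (g p)"
    by metis
  have "open {x. T < fst (g p) \<bullet> x + snd (g p)}" for p
    by (intro open_Collect_less continuous_intros)
  then obtain D where D: "D \<subseteq> C" "finite D" "C \<subseteq> (\<Union>p\<in>D. {x. T < fst (g p) \<bullet> x + snd (g p)})"
    using g(2) by (rule_tac compactE_image[OF C(1), of C "\<lambda>p. {x. T < fst (g p) \<bullet> x + snd (g p)}"]) auto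
  show thesis
    by (rule that[of "g ` D"]) (use D g in auto)
qed

text \<open>A displacement \<open>d\<close> of the combination can be applied to both
  \<open>x\<close> and \<open>y\<close>, and the displaced points remain in
  \<open>S\<close>.\<close>

lemma convex_inner_neighbourhood:
  fixes S :: "'a::real_normed_vector set"
  assumes "convex S"
  shows "convex {x. ball x r \<subseteq> S}"
proof (intro convexI subsetI CollectI)
  fix x y z and u v :: real
  assume x: "x \<in> {x. ball x r \<subseteq> S}" and y: "y \<in> {x. ball x r \<subseteq> S}"
    and uv: "0 \<le> u" "0 \<le> v" "u + v = 1" and z: "z \<in> ball (u *\<^sub>R x + v *\<^sub>R y) r"
  define d where "d = z - (u *\<^sub>R x + v *\<^sub>R y)"
  have "norm d < r"
    using z by (simp add: d_def dist_norm norm_minus_commute)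
  then have "x + d \<in> S" "y + d \<in> S"
    using x y by (auto simp: subset_eq dist_norm)
  then have "u *\<^sub>R (x + d) + v *\<^sub>R (y + d) \<in> S"
    using assms uv by (intro convexD) auto
  moreover have "u *\<^sub>R (x + d) + v *\<^sub>R (y + d) = u *\<^sub>R x + v *\<^sub>R y + (u + v) *\<^sub>R d"
    by (simp add: algebra_simps)
  ultimately show "z \<in> S"
    using uv by (simp add: d_def)
qed

lemma closed_inner_neighbourhood:
  fixes S :: "'a::metric_space set"
  shows "closed {x. ball x r \<subseteq> S}"
proof -
  have "{x. ball x r \<subseteq> S} = - (\<Union>y\<in>- S. ball y r)"
    by (auto simp: subset_eq dist_commute)
  then show ?thesis by auto
qed

lemma exists_exhausting_halfspaces:
  fixes S :: "'a::euclidean_space set"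
  assumes "open S" "convex S"
  obtains A where "locally_finite_halfspaces S A"
    "\<And>p T. p \<in> frontier S \<Longrightarrow> \<exists>a\<in>A. T < fst a \<bullet> p + snd a"
proof -
  \<comment> \<open>Points of norm at most \<open>j\<close> whose distance to the complement is at
    least \<open>1 / Suc j\<close>; \<open>Suc\<close> avoids a zero denominator at
    \<open>j = 0\<close>.\<close>
  define K where "K j = cball 0 (real j) \<inter> {x. ball x (1 / Suc j) \<subseteq> S}" for j
  have "convex (K j)" "compact (K j)" for j
    unfolding K_def
    by (intro convex_Int convex_cball convex_inner_neighbourhood assms
        compact_Int_closed compact_cball closed_inner_neighbourhood)+
  moreover have "compact (frontier S \<inter> cball 0 (real j))" for j
    by (intro closed_Int_compact frontier_closed compact_cball)
  moreover have "K j \<subseteq> S" for j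
    by (auto simp: K_def)
  then have "(frontier S \<inter> cball 0 (real j)) \<inter> K j = {}" for j
    using assms(1) by (auto simp: frontier_def interior_open)
  ultimately have "\<exists>A. finite A \<and> (\<forall>a\<in>A. \<forall>x\<in>K j. fst a \<bullet> x + snd a \<le> 0) \<and>
      (\<forall>p\<in>frontier S \<inter> cball 0 (real j). \<exists>a\<in>A. real j < fst a \<bullet> p + snd a)" for j
    by (metis separating_affine_functions)
  then obtain A where A: "\<And>j. finite (A j)"
      "\<And>j a x. a \<in> A j \<Longrightarrow> x \<in> K j \<Longrightarrow> fst a \<bullet> x + snd a \<le> 0"
      "\<And>j p. p \<in> frontier S \<Longrightarrow> norm p \<le> real j \<Longrightarrow> \<exists>a\<in>A j. real j < fst a \<bullet> p + snd a"
    by (metis IntI mem_cball_0)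
  have "locally_finite_halfspaces S (\<Union>j. A j)"
    unfolding locally_finite_halfspaces_def
  proof
    fix x assume "x \<in> S"
    then obtain e where e: "e > 0" "ball x e \<subseteq> S"
      using assms(1) open_contains_ball by blast
    \<comment> \<open>The first bound keeps \<open>ball x (e / 2)\<close> within norm
      \<open>j\<close>; the second makes the margin \<open>1 / Suc j\<close> fit in the remaining
      \<open>e / 2\<close>. Thus only the families \<open>A j\<close> with \<open>j < J\<close> can
      be positive near \<open>x\<close>.\<close>
    obtain J :: nat where J: "J > max (norm x + e) (2 / e)"
      using reals_Archimedean2 by blast
    have "ball x (e / 2) \<subseteq> K j" if "j \<ge> J" for j
    proof
      fix y assume y: "y \<in> ball x (e / 2)"
      have "norm y \<le> norm x + dist x y"
        by (metis dist_norm norm_triangle_sub norm_minus_commute)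
      then have "norm y \<le> real j"
        using y J that e(1) by auto
      moreover have "2 / e < Suc j" using J that by simp
      then have "1 / Suc j \<le> e / 2"
        using e(1) by (simp add: field_simps)
      then have "dist x y + 1 / Suc j \<le> e"
        using y by simp
      then have "ball y (1 / Suc j) \<subseteq> ball x e"
        by (simp add: ball_subset_ball_iff dist_commute)
      ultimately show "y \<in> K j"
        using e(2) by (auto simp: K_def)
    qed
    then have "a \<in> (\<Union>j<J. A j)" if "a \<in> A j" "y \<in> ball x (e / 2)" "0 < fst a \<bullet> y + snd a" for a j y
      using A(2)[of a j y] that by (metis UN_I leD lessThan_iff not_le subsetD)
    then have "{a \<in> \<Union>j. A j. \<exists>y\<in>ball x (e / 2). 0 < fst a \<bullet> y + snd a} \<subseteq> (\<Union>j<J. A j)"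
      by blast
    then have "finite {a \<in> \<Union>j. A j. \<exists>y\<in>ball x (e / 2). 0 < fst a \<bullet> y + snd a}"
      by (rule finite_subset) (simp add: A(1))
    then show "\<exists>U. open U \<and> x \<in> U \<and> finite {a \<in> \<Union>j. A j. \<exists>y\<in>U. 0 < fst a \<bullet> y + snd a}"
      using e(1) by (intro exI[of _ "ball x (e / 2)"]) auto
  qed
  moreover have "\<exists>a\<in>\<Union>j. A j. T < fst a \<bullet> p + snd a" if "p \<in> frontier S" for p T
  proof -
    \<comment> \<open>\<open>j > norm p\<close> puts \<open>p\<close> among the boundary points
      treated at stage \<open>j\<close>, and \<open>j > T\<close> gives the required value.\<close>
    obtain j :: nat where j: "j > max (norm p) T"
      using reals_Archimedean2 by blast
    with A(3)[OF that, of j] obtain a where "a \<in> A j" "real j < fst a \<bullet> p + snd a"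
      by auto
    with j show ?thesis by (intro bexI[of _ a]) auto
  qed
  ultimately show thesis by (rule that)
qed

text \<open>The term \<open>x \<bullet> x\<close> bounds sublevel sets. They are closed because a
  limit on the frontier would force a single summand above \<open>c\<close>, while limits in
  \<open>S\<close> are handled by continuity.\<close>

lemma exhaustion_function_inner_self_plus_ridge_sum:
  fixes S :: "(real^'n) set"
  assumes S: "open S" and A: "locally_finite_halfspaces S A"
    and unbounded: "\<And>p T. p \<in> frontier S \<Longrightarrow> \<exists>a\<in>A. T < fst a \<bullet> p + snd a"
  shows "exhaustion_function S (\<lambda>x. x \<bullet> x + ridge_sum A (\<lambda>_. 1) (flat 0) x)" (is "exhaustion_function S ?f")
  unfolding exhaustion_function_def
proof
  fix c
  define L where "L = {x \<in> S. ?f x \<le> c}"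
  have "norm x \<le> sqrt c" if "x \<in> L" for x
  proof -
    have "0 \<le> ridge_sum A (\<lambda>_. 1) (flat 0) x"
      by (intro ridge_sum_nonneg flat_0_nonneg) simp
    with that show ?thesis
      by (simp add: L_def norm_eq_sqrt_inner)
  qed
  then have "bounded L"
    by (auto simp: bounded_iff)
  moreover have "p \<in> L" if s: "\<And>n. s n \<in> L" "s \<longlonglongrightarrow> p" for s p
  proof -
    have "p \<in> S"
    proof (rule ccontr)
      assume "p \<notin> S"
      moreover have "p \<in> closure S"
        using s by (auto simp: closure_sequential L_def)
      ultimately have "p \<in> frontier S"
        using S by (simp add: frontier_def interior_open)
      \<comment> \<open>The bound \<open>1\<close> makes \<open>flat_0_ge\<close> applicable, and
        \<open>c * exp 1\<close> makes its lower bound exceed \<open>c\<close>. Both strict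
        inequalities persist at nearby points of the sequence.\<close>
      then obtain a where a: "a \<in> A" "max 1 (c * exp 1) < fst a \<bullet> p + snd a"
        using unbounded by blast
      have "(\<lambda>n. fst a \<bullet> s n + snd a) \<longlonglongrightarrow> fst a \<bullet> p + snd a"
        by (intro tendsto_intros s)
      then have "\<forall>\<^sub>F n in sequentially. max 1 (c * exp 1) < fst a \<bullet> s n + snd a"
        using a(2) by (rule order_tendstoD)
      then obtain n where n: "max 1 (c * exp 1) < fst a \<bullet> s n + snd a"
        using eventually_happens' sequentially_bot by blast
      have "c < (fst a \<bullet> s n + snd a) * exp (- 1)"
        using n by (simp add: exp_minus field_simps)
      also have "\<dots> \<le> 1 * flat 0 (fst a \<bullet> s n + snd a)"
        using flat_0_ge n by simp
      also have "\<dots> \<le> ridge_sum A (\<lambda>_. 1) (flat 0) (s n)"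
        using s(1)[of n] n a(1)
        by (intro ridge_sum_ge_summand[OF A] flat_0_nonneg) (auto simp: L_def)
      also have "\<dots> \<le> ?f (s n)" by simp
      finally show False using s(1)[of n] by (simp add: L_def)
    qed
    have "continuous_on S ?f"
      by (intro continuous_intros) (use C_k_on_ridge_sum[OF S A, of 0] in auto)
    then have "isCont ?f p"
      using S \<open>p \<in> S\<close> by (simp add: continuous_on_eq_continuous_at)
    then have "(\<lambda>n. ?f (s n)) \<longlonglongrightarrow> ?f p"
      using s(2) by (rule isCont_tendsto_compose)
    then have "?f p \<le> c"
      by (rule LIMSEQ_le_const2) (use s(1) in \<open>auto simp: L_def\<close>)
    with \<open>p \<in> S\<close> show ?thesis by (simp add: L_def)
  qed
  then have "closed L"
    by (auto simp: closed_sequential_limits)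
  ultimately show "compact {x \<in> S. ?f x \<le> c}"
    by (simp add: compact_eq_bounded_closed L_def)
qed

theorem theorem13:
  fixes \<Omega> :: "(real^'n) set"
  assumes "open \<Omega>" and "connected \<Omega>"
  shows "convex \<Omega> \<longleftrightarrow>
    (\<exists>f. C_infinity_on \<Omega> f \<and> strictly_convex_on \<Omega> f \<and> exhaustion_function \<Omega> f)"
proof
  assume "convex \<Omega>"
  then obtain A where "locally_finite_halfspaces \<Omega> A"
    "\<And>p T. p \<in> frontier \<Omega> \<Longrightarrow> \<exists>a\<in>A. T < fst a \<bullet> p + snd a"
    using exists_exhausting_halfspaces[OF assms(1)] by blast
  then show "\<exists>f. C_infinity_on \<Omega> f \<and> strictly_convex_on \<Omega> f \<and> exhaustion_function \<Omega> f"
    using strictly_convex_on_inner_self_plus_ridge_sum[OF assms(1)]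
      exhaustion_function_inner_self_plus_ridge_sum[OF assms(1)] by blast
next
  assume "\<exists>f. C_infinity_on \<Omega> f \<and> strictly_convex_on \<Omega> f \<and> exhaustion_function \<Omega> f"
  then show "convex \<Omega>"
    using convex_of_strictly_convex_exhaustion[OF assms] by blast
qed

end
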